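(* Let $a,b\ge 1$ be integers, let $G$ be a finite non-empty $(a,b)$-biregular graph with partition classes $\mathcal{E}_G$ (vertices of degree $a$) and $\mathcal{O}_G$ (vertices of degree $b$), let $m\in\mathbb{N}$, $m \geq 1$, and let $W$ be any system of non-negative real weights on $G$ with spin set $\{1,\ldots,m\}$. For each $v\in\mathcal{O}_G$ let $W^v$ be the system of weights on the complete bipartite graph $K_{a,b}$ induced by $W$ and $v$, as defined in the context. Then $$ Z^{W}(G)\ \le\ \prod_{v\in\mathcal{O}_G}\left(Z^{W^v}(K_{a,b})\right)^{\frac1a}. $$
   Context: Graphs are simple and finite. An $(a,b)$-biregular graph is a bipartite graph $G$ with a bipartition into classes $\mathcal{E}_G$ and $\mathcal{O}_G$ such that every vertex of $\mathcal{E}_G$ has degree $a$ and every vertex of $\mathcal{O}_G$ has degree $b$. Weights and partition function. Fix $m\in\mathbb{N}$ and a graph $G=(V,E)$. A system of weights $W$ on $G$ consists of a non-negative real $\lambda_{i,v}$ for each $1\le i\le m$ and $v\in V$, and a non-negative real $\lambda_{ij,uv}$ for each $1\le i\le j\le m$ and each edge $uv\in E$; set $\lambda_{ij,uv}:=\lambda_{ji,uv}$ for $i>j$ (so the edge weights are symmetric in the two spins and attached to unordered edges). For $f:V\to\{1,\ldots,m\}$ put $$ w^W(f)=\prod_{v\in V}\lambda_{f(v),v}\prod_{uv\in E}\lambda_{f(u)f(v),uv},\qquad Z^W(G)=\sum_{f:V\to\{1,\ldots,m\}}w^W(f). $$ Induced weights $W^v$. Let $K_{a,b}$ be the complete bipartite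 graph with classes $\{w_1,\ldots,w_b\}$ (the vertices of degree $a$) and $\{z_1,\ldots,z_a\}$ (the vertices of degree $b$). For $v\in\mathcal{O}_G$ write $\{n_1(v),\ldots,n_b(v)\}$ for the set of neighbours of $v$ in $G$. The system $W^v$ on $K_{a,b}$ (with the same $m$) has vertex weights $\lambda^v_{i,z_\ell}=\lambda_{i,v}$ for $1\le \ell\le a$ and $\lambda^v_{i,w_k}=\lambda_{i,n_k(v)}$ for $1\le k\le b$, and edge weights $\lambda^v_{ij,w_kz_\ell}=\lambda_{ij,n_k(v)v}$ for $1\le k\le b$, $1\le\ell\le a$. *)

theory Defs
  imports Complex_Main "HOL-Library.FuncSet"
begin

record 'v sgraph =
  verts :: "'v set"
  edges :: "'v set set"

definition simple_graph :: "'v sgraph \<Rightarrow> bool" where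
  "simple_graph G \<longleftrightarrow>
     finite (verts G) \<and> (\<forall>e\<in>edges G. e \<subseteq> verts G \<and> card e = 2)"

definition neighbours :: "'v sgraph \<Rightarrow> 'v \<Rightarrow> 'v set" where
  "neighbours G v = {u \<in> verts G. {u, v} \<in> edges G}"

definition degree :: "'v sgraph \<Rightarrow> 'v \<Rightarrow> nat" where
  "degree G v = card (neighbours G v)"

definition bipartition :: "'v sgraph \<Rightarrow> 'v set \<Rightarrow> 'v set \<Rightarrow> bool" where
  "bipartition G A B \<longleftrightarrow>
     A \<union> B = verts G \<and> A \<inter> B = {} \<and> (\<forall>e\<in>edges G. \<exists>u\<in>A. \<exists>v\<in>B. e = {u, v})"

definition biregular :: "nat \<Rightarrow> nat \<Rightarrow> 'v sgraph \<Rightarrow> 'v set \<Rightarrow> 'v set \<Rightarrow> bool" where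
  "biregular a b G A B \<longleftrightarrow>
     simple_graph G \<and> bipartition G A B \<and>
     (\<forall>u\<in>A. degree G u = a) \<and> (\<forall>v\<in>B. degree G v = b)"

text \<open>
  The weight $\lambda_{ij,uv}$ is \<open>eweight W {i, j} {u, v}\<close>. The pairs $i \le j$ correspond
  one-to-one to the sets \<open>{i, j}\<close> (a singleton when $i = j$), so the convention
  $\lambda_{ij,uv} = \lambda_{ji,uv}$ is built in.
\<close>

record 'v weights =
  vweight :: "nat \<Rightarrow> 'v \<Rightarrow> real"
  eweight :: "nat set \<Rightarrow> 'v set \<Rightarrow> real"

definition weight_system :: "nat \<Rightarrow> 'v sgraph \<Rightarrow> 'v weights \<Rightarrow> bool" where
  "weight_system m G W \<longleftrightarrow>
     (\<forall>i\<in>{1..m}. \<forall>v\<in>verts G. 0 \<le> vweight W i v) \<and>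
     (\<forall>i\<in>{1..m}. \<forall>j\<in>{1..m}. \<forall>e\<in>edges G. 0 \<le> eweight W {i, j} e)"

text \<open>For an edge \<open>e = {u, v}\<close> the image \<open>f ` e\<close> is the unordered pair of spins \<open>{f u, f v}\<close>.\<close>

definition config_weight :: "'v sgraph \<Rightarrow> 'v weights \<Rightarrow> ('v \<Rightarrow> nat) \<Rightarrow> real" where
  "config_weight G W f =
     (\<Prod>v\<in>verts G. vweight W (f v) v) * (\<Prod>e\<in>edges G. eweight W (f ` e) e)"

definition partition_fun :: "nat \<Rightarrow> 'v sgraph \<Rightarrow> 'v weights \<Rightarrow> real" where
  "partition_fun m G W = (\<Sum>f \<in> verts G \<rightarrow>\<^sub>E {1..m}. config_weight G W f)"

text \<open>The vertex $w_k$ of $K_{a,b}$ is \<open>Inl k\<close> and the vertex $z_\ell$ is \<open>Inr l\<close>.\<close>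

definition complete_bipartite :: "nat \<Rightarrow> nat \<Rightarrow> (nat + nat) sgraph" where
  "complete_bipartite a b =
     \<lparr>verts = Inl ` {1..b} \<union> Inr ` {1..a},
      edges = {{Inl k, Inr l} | k l. k \<in> {1..b} \<and> l \<in> {1..a}}\<rparr>"

text \<open>
  The system $W^v$, where \<open>n 1, \<dots>, n b\<close> enumerates the neighbours of \<open>v\<close>: the weights are pulled
  back along $w_k \mapsto n_k(v)$, $z_\ell \mapsto v$; \<open>induced_weights_simps\<close> states the result.
\<close>

definition induced_weights ::
  "'v weights \<Rightarrow> (nat \<Rightarrow> 'v) \<Rightarrow> 'v \<Rightarrow> (nat + nat) weights" where
  "induced_weights W n v =
     \<lparr>vweight = (\<lambda>i x. vweight W i (case_sum n (\<lambda>l. v) x)),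
      eweight = (\<lambda>s e. eweight W s (case_sum n (\<lambda>l. v) ` e))\<rparr>"

lemma induced_weights_simps [simp]:
  "vweight (induced_weights W n v) i (Inr l) = vweight W i v"
  "vweight (induced_weights W n v) i (Inl k) = vweight W i (n k)"
  "eweight (induced_weights W n v) s {Inl k, Inr l} = eweight W s {n k, v}"
  by (simp_all add: induced_weights_def)

lemma biregular_complete_bipartite:
  "biregular a b (complete_bipartite a b) (Inl ` {1..b}) (Inr ` {1..a})"
proof -
  let ?K = "complete_bipartite a b"
  have "neighbours ?K (Inl k) = Inr ` {1..a}" if "k \<in> {1..b}" for k
    using that by (auto simp: neighbours_def complete_bipartite_def doubleton_eq_iff)
  moreover have "neighbours ?K (Inr l) = Inl ` {1..b}" if "l \<in> {1..a}" for l
    using that by (auto simp: neighbours_def complete_bipartite_def doubleton_eq_iff)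
  ultimately have deg: "\<forall>u\<in>Inl ` {1..b}. degree ?K u = a" "\<forall>v\<in>Inr ` {1..a}. degree ?K v = b"
    by (auto simp: degree_def card_image)
  have "simple_graph ?K"
    by (auto simp: simple_graph_def complete_bipartite_def)
  moreover have "bipartition ?K (Inl ` {1..b}) (Inr ` {1..a})"
    by (fastforce simp: bipartition_def complete_bipartite_def)
  ultimately show ?thesis
    using deg by (simp add: biregular_def)
qed

end

theory Submission
  imports Defs "HOL-Analysis.Convex"
begin

text \<open>
  Write $N(v)$ for the set of neighbours of $v$. Since the graph is bipartite, once the spins
  $g$ on \<open>EG\<close> are chosen the spins on \<open>OG\<close> can be summed out independently:
  $$Z^W(G) = \sum_g \prod_{u \in \mathcal{E}_G} \lambda_{g(u),u}
     \prod_{v \in \mathcal{O}_G} F_v(g|_{N(v)}), \qquad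
    F_v(h) = \sum_j \lambda_{j,v} \prod_{u \in N(v)} \lambda_{h(u)j,uv}$$
  (\<open>partition_fun_bipartite\<close>). Each factor $F_v$ depends only on the coordinates in $N(v)$, and
  every coordinate $u$ lies in exactly $a$ of the sets $N(v)$ because $u$ has degree $a$. This is
  the situation of Finner's generalisation of Hoelder's inequality (\<open>finner_inequality\<close>): the sum
  is at most the product over $v$ of the $L^a$ norms of the $F_v$ with respect to the product of
  the vertex weights on $N(v)$.

  Applying the same summation to $K_{a,b}$ with the weights $W^v$, the $a$ vertices $z_\ell$
  are copies of $v$ and each contributes the same factor $F_v$, so $Z^{W^v}(K_{a,b})$ is exactly
  the $a$-th power of the $L^a$ norm of $F_v$ (\<open>partition_fun_induced\<close>).

  Finner's inequality itself is proved by removing one coordinate $u$ at a time: Hoelder's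
  inequality for the $a$ factors that contain $u$ replaces each of them by its $L^a$ norm in the
  variable $u$.
\<close>

section \<open>Sums over product sets\<close>

lemma sum_PiE_insert:
  assumes "x \<notin> U"
  shows "(\<Sum>h\<in>PiE (insert x U) (\<lambda>_. S). \<phi> h) = (\<Sum>g\<in>PiE U (\<lambda>_. S). \<Sum>s\<in>S. \<phi> (g(x := s)))"
proof -
  have "(\<Sum>h\<in>PiE (insert x U) (\<lambda>_. S). \<phi> h)
      = (\<Sum>(s, g)\<in>S \<times> PiE U (\<lambda>_. S). \<phi> (g(x := s)))"
    unfolding PiE_insert_eq
    by (subst sum.reindex[OF inj_combinator[OF assms]]) (simp add: case_prod_unfold)
  also have "\<dots> = (\<Sum>s\<in>S. \<Sum>g\<in>PiE U (\<lambda>_. S). \<phi> (g(x := s)))"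
    by (rule sum.cartesian_product[symmetric])
  finally show ?thesis
    by (subst sum.swap)
qed

lemma sum_PiE_Un:
  fixes \<phi> :: "('a \<Rightarrow> 'b) \<Rightarrow> 'c :: comm_monoid_add"
  assumes "A \<inter> B = {}"
  shows "(\<Sum>f\<in>PiE (A \<union> B) (\<lambda>_. S). \<phi> f)
    = (\<Sum>g\<in>PiE A (\<lambda>_. S). \<Sum>h\<in>PiE B (\<lambda>_. S). \<phi> (\<lambda>x. if x \<in> A then g x else h x))"
proof -
  define join where "join = (\<lambda>(g, h :: 'a \<Rightarrow> 'b) x. if x \<in> A then g x else h x)"
  have bij: "bij_betw join (PiE A (\<lambda>_. S) \<times> PiE B (\<lambda>_. S)) (PiE (A \<union> B) (\<lambda>_. S))"
  proof (rule bij_betwI[where g = "\<lambda>f. (restrict f A, restrict f B)"])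
    show "join \<in> PiE A (\<lambda>_. S) \<times> PiE B (\<lambda>_. S) \<rightarrow> PiE (A \<union> B) (\<lambda>_. S)"
      by (force simp: join_def PiE_iff extensional_def)
    show "(\<lambda>f. (restrict f A, restrict f B)) \<in> PiE (A \<union> B) (\<lambda>_. S) \<rightarrow> PiE A (\<lambda>_. S) \<times> PiE B (\<lambda>_. S)"
      by (auto simp: PiE_iff)
  next
    fix p assume "p \<in> PiE A (\<lambda>_. S) \<times> PiE B (\<lambda>_. S)"
    then obtain g h where p: "p = (g, h)" and g: "g \<in> extensional A" and h: "h \<in> extensional B"
      by (auto simp: PiE_iff)
    have "restrict (join p) A = g"
      using g by (intro extensionalityI[of _ A]) (simp_all add: p join_def)
    moreover have "restrict (join p) B = h"
      using h assms by (intro extensionalityI[of _ B]) (auto simp: p join_def)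
    ultimately show "(restrict (join p) A, restrict (join p) B) = p"
      by (simp add: p)
  next
    fix f assume "f \<in> PiE (A \<union> B) (\<lambda>_. S)"
    hence "f x = undefined" if "x \<notin> A \<union> B" for x
      using that by (rule PiE_arb)
    thus "join (restrict f A, restrict f B) = f"
      unfolding join_def by (intro ext) simp
  qed
  show ?thesis
    unfolding sum.reindex_bij_betw[OF bij, symmetric] sum.cartesian_product
    by (simp add: join_def case_prod_unfold)
qed

lemma sum_PiE_reindex:
  assumes "bij_betw \<phi> I J"
  shows "(\<Sum>g\<in>PiE I (\<lambda>_. S). \<Phi> g) = (\<Sum>h\<in>PiE J (\<lambda>_. S). \<Phi> (restrict (h \<circ> \<phi>) I))"
proof -
  let ?\<psi> = "the_inv_into I \<phi>"
  have inj: "inj_on \<phi> I" and im: "\<phi> ` I = J"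
    using assms by (auto simp: bij_betw_def)
  have \<psi>: "?\<psi> (\<phi> i) = i" if "i \<in> I" for i
    using inj that by (rule the_inv_into_f_f)
  have \<phi>: "\<phi> i \<in> J" if "i \<in> I" for i
    using im that by blast
  have \<psi>J: "?\<psi> j \<in> I" "\<phi> (?\<psi> j) = j" if "j \<in> J" for j
    using inj that im by (simp_all add: the_inv_into_into f_the_inv_into_f)
  show ?thesis
  proof (rule sum.reindex_bij_witness
      [where i = "\<lambda>h. restrict (h \<circ> \<phi>) I" and j = "\<lambda>g. restrict (g \<circ> ?\<psi>) J"])
    fix g assume g: "g \<in> PiE I (\<lambda>_. S)"
    show eq: "restrict (restrict (g \<circ> ?\<psi>) J \<circ> \<phi>) I = g"
      using PiE_arb[OF g] \<phi> by (intro ext) (simp add: \<psi>)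
    show "restrict (g \<circ> ?\<psi>) J \<in> PiE J (\<lambda>_. S)"
      using PiE_mem[OF g] \<psi>J(1) by simp
    show "\<Phi> (restrict (restrict (g \<circ> ?\<psi>) J \<circ> \<phi>) I) = \<Phi> g"
      using eq by simp
  next
    fix h assume h: "h \<in> PiE J (\<lambda>_. S)"
    show "restrict (restrict (h \<circ> \<phi>) I \<circ> ?\<psi>) J = h"
      using PiE_arb[OF h] \<psi>J by (intro ext) simp
    show "restrict (h \<circ> \<phi>) I \<in> PiE I (\<lambda>_. S)"
      using PiE_mem[OF h] \<phi> by simp
  qed
qed

section \<open>Hoelder's inequality for several factors\<close>

text \<open>
  The inequality between arithmetic and geometric mean for the numbers $y_v^a$; the normalised
  form of Hoelder's inequality is its integral.
\<close>

lemma prod_le_mean_power: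
  fixes y :: "'v \<Rightarrow> real"
  assumes "finite V" "card V = a" "a \<ge> 1" "\<And>v. v \<in> V \<Longrightarrow> 0 \<le> y v"
  shows "(\<Prod>v\<in>V. y v) \<le> (\<Sum>v\<in>V. y v ^ a) / real a"
proof -
  have pos: "0 \<le> (\<Prod>v\<in>V. y v)"
    using assms by (simp add: prod_nonneg)
  have "(\<Prod>v\<in>V. y v ^ a) powr (1 / real a) = root a ((\<Prod>v\<in>V. y v) ^ a)"
    using assms(3) pos by (simp add: root_powr_inverse flip: prod_power_distrib)
  also have "\<dots> = (\<Prod>v\<in>V. y v)"
    using assms pos by (simp add: real_root_power_cancel)
  finally have "(\<Prod>v\<in>V. y v) = (\<Prod>v\<in>V. y v ^ a) powr (1 / real a)" ..
  also have "\<dots> \<le> (\<Sum>v\<in>V. y v ^ a / real a)"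
    using arith_geom_mean[of V "\<lambda>v. y v ^ a"] assms by fastforce
  finally show ?thesis
    by (simp add: sum_divide_distrib)
qed

text \<open>
  If one of the norms vanishes then so does every summand on the left. Otherwise divide each
  factor by its norm: the sum of the means in \<open>prod_le_mean_power\<close> is then 1.
\<close>

lemma hoelder_prod:
  fixes f :: "'v \<Rightarrow> 's \<Rightarrow> real" and \<mu> :: "'s \<Rightarrow> real"
  assumes fin: "finite S" "finite V" and card: "card V = a" and a: "a \<ge> 1"
    and \<mu>: "\<And>s. s \<in> S \<Longrightarrow> 0 \<le> \<mu> s"
    and f: "\<And>v s. v \<in> V \<Longrightarrow> s \<in> S \<Longrightarrow> 0 \<le> f v s"
  shows "(\<Sum>s\<in>S. \<mu> s * (\<Prod>v\<in>V. f v s)) \<le> (\<Prod>v\<in>V. root a (\<Sum>s\<in>S. \<mu> s * f v s ^ a))"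
proof -
  define M where "M v = (\<Sum>s\<in>S. \<mu> s * f v s ^ a)" for v
  define c where "c v = root a (M v)" for v
  have M0: "0 \<le> M v" if "v \<in> V" for v
    unfolding M_def using that \<mu> f by (intro sum_nonneg) simp
  have c0: "0 \<le> c v" and ca: "c v ^ a = M v" if "v \<in> V" for v
    using M0[OF that] a by (simp_all add: c_def)
  have "(\<Sum>s\<in>S. \<mu> s * (\<Prod>v\<in>V. f v s)) \<le> (\<Prod>v\<in>V. c v)"
  proof (cases "\<exists>v\<in>V. M v = 0")
    case True
    then obtain v where v: "v \<in> V" "M v = 0" by blast
    have "\<mu> s * (\<Prod>v\<in>V. f v s) = 0" if s: "s \<in> S" for s
    proof -
      have "\<mu> s * f v s ^ a = 0"
        using v s fin(1) \<mu> f unfolding M_def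
        by (subst (asm) sum_nonneg_eq_0_iff) auto
      hence "\<mu> s = 0 \<or> f v s = 0" by auto
      thus ?thesis using v fin(2) by auto
    qed
    hence "(\<Sum>s\<in>S. \<mu> s * (\<Prod>v\<in>V. f v s)) = 0"
      by (intro sum.neutral) blast
    moreover have "0 \<le> (\<Prod>v\<in>V. c v)"
      using c0 by (simp add: prod_nonneg)
    ultimately show ?thesis by simp
  next
    case False
    have Mpos: "0 < M v" if "v \<in> V" for v
      using False M0[OF that] that by force
    have cpos: "0 < c v" if "v \<in> V" for v
      using Mpos[OF that] a by (simp add: c_def)
    have "(\<Sum>s\<in>S. \<mu> s * (\<Prod>v\<in>V. f v s)) = (\<Prod>v\<in>V. c v) * (\<Sum>s\<in>S. \<mu> s * (\<Prod>v\<in>V. f v s / c v))"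
    proof -
      have "(\<Prod>v\<in>V. f v s) = (\<Prod>v\<in>V. c v) * (\<Prod>v\<in>V. f v s / c v)" for s
        unfolding prod.distrib[symmetric] using cpos by (intro prod.cong) fastforce+
      thus ?thesis by (simp add: sum_distrib_left mult.left_commute)
    qed
    also have "\<dots> \<le> (\<Prod>v\<in>V. c v) * 1"
    proof (rule mult_left_mono)
      have "(\<Sum>s\<in>S. \<mu> s * (\<Prod>v\<in>V. f v s / c v))
          \<le> (\<Sum>s\<in>S. \<mu> s * ((\<Sum>v\<in>V. (f v s / c v) ^ a) / real a))"
        using fin card a \<mu> f c0
        by (intro sum_mono mult_left_mono prod_le_mean_power) auto
      also have "\<dots> = (\<Sum>v\<in>V. \<Sum>s\<in>S. \<mu> s * f v s ^ a / M v) / real a"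
        by (subst sum.swap)
          (simp add: sum_divide_distrib sum_distrib_left power_divide ca cong: sum.cong)
      also have "\<dots> = (\<Sum>v\<in>V. 1) / real a"
        using Mpos by (intro arg_cong2[where f = "(/)"] sum.cong)
          (fastforce simp: M_def simp flip: sum_divide_distrib)+
      also have "\<dots> = 1"
        using card a by simp
      finally show "(\<Sum>s\<in>S. \<mu> s * (\<Prod>v\<in>V. f v s / c v)) \<le> 1" .
      show "0 \<le> (\<Prod>v\<in>V. c v)"
        using c0 by (simp add: prod_nonneg)
    qed
    finally show ?thesis by simp
  qed
  thus ?thesis by (simp add: c_def M_def)
qed

section \<open>Finner's inequality\<close>

text \<open>
  By induction on \<open>U\<close>. To remove the coordinate \<open>x\<close>, fix the other ones and apply
  \<open>hoelder_prod\<close> to the \<open>a\<close> factors with \<open>x \<in> N v\<close>. This replaces \<open>F v\<close> by its norm in the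
  variable \<open>x\<close>, a function of the coordinates in \<open>N v - {x}\<close>, whose norm in those coordinates is
  the norm of \<open>F v\<close>.
\<close>

lemma finner_inequality:
  fixes F :: "'v \<Rightarrow> ('u \<Rightarrow> 's) \<Rightarrow> real" and \<mu> :: "'u \<Rightarrow> 's \<Rightarrow> real"
  assumes "finite U" and "finite V" and "finite S" and "a \<ge> 1"
    and "\<And>v. v \<in> V \<Longrightarrow> N v \<subseteq> U"
    and "\<And>u. u \<in> U \<Longrightarrow> card {v \<in> V. u \<in> N v} = a"
    and "\<And>u s. u \<in> U \<Longrightarrow> s \<in> S \<Longrightarrow> 0 \<le> \<mu> u s"
    and "\<And>v g. v \<in> V \<Longrightarrow> g \<in> PiE (N v) (\<lambda>_. S) \<Longrightarrow> 0 \<le> F v g"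
  shows "(\<Sum>g\<in>PiE U (\<lambda>_. S). (\<Prod>u\<in>U. \<mu> u (g u)) * (\<Prod>v\<in>V. F v (restrict g (N v))))
    \<le> (\<Prod>v\<in>V. root a (\<Sum>h\<in>PiE (N v) (\<lambda>_. S). (\<Prod>u\<in>N v. \<mu> u (h u)) * F v h ^ a))"
  using assms(1,5-8)
proof (induction U arbitrary: N F rule: finite_induct)
  case empty
  have N: "N v = {}" if "v \<in> V" for v
    using empty.prems(1) that by blast
  have "F v (\<lambda>x. undefined) = root a (\<Sum>h\<in>PiE (N v) (\<lambda>_. S). (\<Prod>u\<in>N v. \<mu> u (h u)) * F v h ^ a)"
    if "v \<in> V" for v
    using empty.prems(4)[OF that, of "\<lambda>x. undefined"] \<open>a \<ge> 1\<close>
    by (simp add: N[OF that] real_root_power_cancel)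
  moreover have "restrict (\<lambda>x. undefined) (N v) = (\<lambda>x. undefined)" if "v \<in> V" for v
    by (simp add: N[OF that] restrict_def)
  ultimately show ?case
    by simp
next
  case (insert x U)
  define N' where "N' v = N v - {x}" for v
  define Vx where "Vx = {v \<in> V. x \<in> N v}"
  define F' where "F' v g =
    (if x \<in> N v then root a (\<Sum>s\<in>S. \<mu> x s * F v (g(x := s)) ^ a) else F v g)" for v g
  have Vx: "Vx \<subseteq> V" "finite Vx" "card Vx = a"
    using \<open>finite V\<close> insert.prems(2)[of x] by (auto simp: Vx_def)
  have \<mu>: "0 \<le> \<mu> u s" if "u \<in> insert x U" "s \<in> S" for u s
    using insert.prems(3) that by blast
  have F: "0 \<le> F v g" if "v \<in> V" "g \<in> PiE (N v) (\<lambda>_. S)" for v g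
    using insert.prems(4) that by blast
  have upd: "g(x := s) \<in> PiE (N v) (\<lambda>_. S)"
    if "x \<in> N v" "g \<in> PiE (N' v) (\<lambda>_. S)" "s \<in> S" for v g s
  proof -
    have "insert x (N' v) = N v"
      using that(1) by (auto simp: N'_def)
    thus ?thesis
      using PiE_fun_upd[OF that(3,2), of x] by simp
  qed
  have power0: "0 \<le> (\<Sum>s\<in>S. \<mu> x s * F v (g(x := s)) ^ a)"
    if "v \<in> V" "x \<in> N v" "g \<in> PiE (N' v) (\<lambda>_. S)" for v g
    using that F[OF that(1) upd[OF that(2,3)]] \<mu>[of x] by (intro sum_nonneg) simp
  have restr: "restrict g (N' v) \<in> PiE (N' v) (\<lambda>_. S)"
    if "v \<in> V" "g \<in> PiE U (\<lambda>_. S)" for v g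
    using that insert.prems(1)[OF that(1)] by (auto simp: N'_def)
  have F'0: "0 \<le> F' v g" if "v \<in> V" "g \<in> PiE (N' v) (\<lambda>_. S)" for v g
    using that F[of v g] power0[of v g] \<open>a \<ge> 1\<close> by (auto simp: F'_def N'_def)
  have step: "(\<Sum>s\<in>S. (\<Prod>u\<in>insert x U. \<mu> u ((g(x := s)) u)) *
        (\<Prod>v\<in>V. F v (restrict (g(x := s)) (N v))))
      \<le> (\<Prod>u\<in>U. \<mu> u (g u)) * (\<Prod>v\<in>V. F' v (restrict g (N' v)))"
    if g: "g \<in> PiE U (\<lambda>_. S)" for g
  proof -
    let ?r = "\<lambda>v. restrict g (N' v)"
    have *: "(\<Prod>u\<in>insert x U. \<mu> u ((g(x := s)) u)) * (\<Prod>v\<in>V. F v (restrict (g(x := s)) (N v)))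
        = ((\<Prod>u\<in>U. \<mu> u (g u)) * (\<Prod>v\<in>V - Vx. F v (?r v))) * (\<mu> x s * (\<Prod>v\<in>Vx. F v ((?r v)(x := s))))"
      if "s \<in> S" for s
    proof -
      have "(\<Prod>u\<in>insert x U. \<mu> u ((g(x := s)) u)) = \<mu> x s * (\<Prod>u\<in>U. \<mu> u ((g(x := s)) u))"
        using insert.hyps by simp
      also have "(\<Prod>u\<in>U. \<mu> u ((g(x := s)) u)) = (\<Prod>u\<in>U. \<mu> u (g u))"
        using insert.hyps by (intro prod.cong) auto
      finally have 1: "(\<Prod>u\<in>insert x U. \<mu> u ((g(x := s)) u)) = \<mu> x s * (\<Prod>u\<in>U. \<mu> u (g u))" .
      have "(\<Prod>v\<in>V. F v (restrict (g(x := s)) (N v)))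
          = (\<Prod>v\<in>V - Vx. F v (restrict (g(x := s)) (N v))) * (\<Prod>v\<in>Vx. F v (restrict (g(x := s)) (N v)))"
        using Vx \<open>finite V\<close> by (intro prod.subset_diff)
      also have "(\<Prod>v\<in>V - Vx. F v (restrict (g(x := s)) (N v))) = (\<Prod>v\<in>V - Vx. F v (?r v))"
        by (intro prod.cong arg_cong2[where f = F]) (auto simp: Vx_def N'_def fun_eq_iff restrict_def)
      also have "(\<Prod>v\<in>Vx. F v (restrict (g(x := s)) (N v))) = (\<Prod>v\<in>Vx. F v ((?r v)(x := s)))"
        by (intro prod.cong arg_cong2[where f = F]) (auto simp: Vx_def N'_def fun_eq_iff restrict_def)
      finally show ?thesis
        unfolding 1 by (simp only: mult_ac)
    qed
    have r: "?r v \<in> PiE (N' v) (\<lambda>_. S)" if "v \<in> V" for v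
      using restr[OF that g] .
    have "(\<Sum>s\<in>S. (\<Prod>u\<in>insert x U. \<mu> u ((g(x := s)) u)) *
          (\<Prod>v\<in>V. F v (restrict (g(x := s)) (N v))))
        = ((\<Prod>u\<in>U. \<mu> u (g u)) * (\<Prod>v\<in>V - Vx. F v (?r v))) *
          (\<Sum>s\<in>S. \<mu> x s * (\<Prod>v\<in>Vx. F v ((?r v)(x := s))))"
      unfolding sum_distrib_left by (rule sum.cong[OF refl *])
    also have "\<dots> \<le> ((\<Prod>u\<in>U. \<mu> u (g u)) * (\<Prod>v\<in>V - Vx. F v (?r v))) *
        (\<Prod>v\<in>Vx. root a (\<Sum>s\<in>S. \<mu> x s * F v ((?r v)(x := s)) ^ a))"
    proof (rule mult_left_mono)
      show "(\<Sum>s\<in>S. \<mu> x s * (\<Prod>v\<in>Vx. F v ((?r v)(x := s))))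
          \<le> (\<Prod>v\<in>Vx. root a (\<Sum>s\<in>S. \<mu> x s * F v ((?r v)(x := s)) ^ a))"
        using Vx \<mu> F r upd \<open>finite S\<close> \<open>a \<ge> 1\<close>
        by (intro hoelder_prod) (auto simp: Vx_def)
      have "0 \<le> (\<Prod>u\<in>U. \<mu> u (g u))"
        using \<mu> g by (intro prod_nonneg) auto
      moreover have "0 \<le> (\<Prod>v\<in>V - Vx. F v (?r v))"
      proof (intro prod_nonneg F)
        fix v assume "v \<in> V - Vx"
        thus "v \<in> V" "?r v \<in> PiE (N v) (\<lambda>_. S)"
          using r[of v] by (auto simp: Vx_def N'_def)
      qed
      ultimately show "0 \<le> (\<Prod>u\<in>U. \<mu> u (g u)) * (\<Prod>v\<in>V - Vx. F v (?r v))"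
        by simp
    qed
    also have "(\<Prod>v\<in>V - Vx. F v (?r v)) = (\<Prod>v\<in>V - Vx. F' v (?r v))"
      by (intro prod.cong) (auto simp: Vx_def F'_def)
    also have "(\<Prod>v\<in>Vx. root a (\<Sum>s\<in>S. \<mu> x s * F v ((?r v)(x := s)) ^ a)) = (\<Prod>v\<in>Vx. F' v (?r v))"
      by (intro prod.cong) (auto simp: Vx_def F'_def)
    also have "(\<Prod>u\<in>U. \<mu> u (g u)) * (\<Prod>v\<in>V - Vx. F' v (?r v)) * (\<Prod>v\<in>Vx. F' v (?r v))
        = (\<Prod>u\<in>U. \<mu> u (g u)) * (\<Prod>v\<in>V. F' v (?r v))"
      using prod.subset_diff[OF Vx(1) \<open>finite V\<close>, of "\<lambda>v. F' v (?r v)"] by simp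
    finally show ?thesis .
  qed
  have "(\<Sum>g\<in>PiE (insert x U) (\<lambda>_. S). (\<Prod>u\<in>insert x U. \<mu> u (g u)) * (\<Prod>v\<in>V. F v (restrict g (N v))))
      \<le> (\<Sum>g\<in>PiE U (\<lambda>_. S). (\<Prod>u\<in>U. \<mu> u (g u)) * (\<Prod>v\<in>V. F' v (restrict g (N' v))))"
    unfolding sum_PiE_insert[OF insert.hyps(2)] by (intro sum_mono step)
  also have "\<dots> \<le> (\<Prod>v\<in>V. root a (\<Sum>h\<in>PiE (N' v) (\<lambda>_. S). (\<Prod>u\<in>N' v. \<mu> u (h u)) * F' v h ^ a))"
  proof (rule insert.IH)
    show "N' v \<subseteq> U" if "v \<in> V" for v
      using insert.prems(1)[OF that] by (auto simp: N'_def)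
    show "card {v \<in> V. u \<in> N' v} = a" if "u \<in> U" for u
    proof -
      have "{v \<in> V. u \<in> N' v} = {v \<in> V. u \<in> N v}"
        using that insert.hyps by (auto simp: N'_def)
      thus ?thesis using insert.prems(2)[of u] that by simp
    qed
  qed (use \<mu> F'0 in auto)
  also have "\<dots> = (\<Prod>v\<in>V. root a (\<Sum>h\<in>PiE (N v) (\<lambda>_. S). (\<Prod>u\<in>N v. \<mu> u (h u)) * F v h ^ a))"
  proof (intro prod.cong refl arg_cong[where f = "root a"])
    fix v assume v: "v \<in> V"
    show "(\<Sum>h\<in>PiE (N' v) (\<lambda>_. S). (\<Prod>u\<in>N' v. \<mu> u (h u)) * F' v h ^ a)
        = (\<Sum>h\<in>PiE (N v) (\<lambda>_. S). (\<Prod>u\<in>N v. \<mu> u (h u)) * F v h ^ a)"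
    proof (cases "x \<in> N v")
      case False
      thus ?thesis by (simp add: N'_def F'_def)
    next
      case True
      have N: "N v = insert x (N' v)" and x: "x \<notin> N' v"
        using True by (auto simp: N'_def)
      have fin: "finite (N' v)"
        using insert.prems(1)[OF v] insert.hyps(1) by (auto simp: N'_def intro: finite_subset)
      have "(\<Prod>u\<in>N' v. \<mu> u (h u)) * F' v h ^ a
          = (\<Sum>s\<in>S. (\<Prod>u\<in>N v. \<mu> u ((h(x := s)) u)) * F v (h(x := s)) ^ a)"
        if h: "h \<in> PiE (N' v) (\<lambda>_. S)" for h
      proof -
        have "F' v h ^ a = (\<Sum>s\<in>S. \<mu> x s * F v (h(x := s)) ^ a)"
          using power0[OF v True h] \<open>a \<ge> 1\<close> True by (simp add: F'_def)
        moreover have "(\<Prod>u\<in>N v. \<mu> u ((h(x := s)) u)) = \<mu> x s * (\<Prod>u\<in>N' v. \<mu> u (h u))" for s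
        proof -
          have "(\<Prod>u\<in>N' v. \<mu> u ((h(x := s)) u)) = (\<Prod>u\<in>N' v. \<mu> u (h u))"
            using x by (intro prod.cong) auto
          thus ?thesis
            unfolding N using fin x by simp
        qed
        ultimately show ?thesis
          by (simp add: sum_distrib_left mult_ac)
      qed
      thus ?thesis
        by (simp add: N sum_PiE_insert[OF x])
    qed
  qed
  finally show ?case .
qed

section \<open>Summing out one side of a bipartite graph\<close>

lemma neighbours_subset_bipartition:
  assumes "bipartition G A B" "v \<in> B"
  shows "neighbours G v \<subseteq> A"
  using assms by (fastforce simp: bipartition_def neighbours_def doubleton_eq_iff)

lemma prod_edges_bipartite:
  fixes \<phi> :: "'v set \<Rightarrow> 'c :: comm_monoid_mult"
  assumes "simple_graph G" "bipartition G A B"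
  shows "(\<Prod>e\<in>edges G. \<phi> e) = (\<Prod>v\<in>B. \<Prod>u\<in>neighbours G v. \<phi> {u, v})"
proof -
  have fin: "finite B" "\<And>v. finite (neighbours G v)"
    using assms by (auto simp: simple_graph_def bipartition_def neighbours_def
      intro: finite_subset[of B "verts G"])
  have nb: "neighbours G v \<subseteq> A" if "v \<in> B" for v
    using neighbours_subset_bipartition[OF assms(2) that] .
  have dis: "A \<inter> B = {}"
    using assms by (simp add: bipartition_def)
  have "edges G = (\<lambda>(v, u). {u, v}) ` Sigma B (neighbours G)"
  proof
    show "edges G \<subseteq> (\<lambda>(v, u). {u, v}) ` Sigma B (neighbours G)"
    proof
      fix e assume e: "e \<in> edges G"
      obtain u v where uv: "u \<in> A" "v \<in> B" "e = {u, v}"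
        using assms(2) e by (auto simp: bipartition_def)
      moreover have "u \<in> neighbours G v"
        using assms(2) uv e by (auto simp: bipartition_def neighbours_def)
      ultimately show "e \<in> (\<lambda>(v, u). {u, v}) ` Sigma B (neighbours G)"
        by force
    qed
    show "(\<lambda>(v, u). {u, v}) ` Sigma B (neighbours G) \<subseteq> edges G"
      by (auto simp: neighbours_def)
  qed
  moreover have "inj_on (\<lambda>(v, u). {u, v}) (Sigma B (neighbours G))"
    using nb dis by (auto simp: inj_on_def doubleton_eq_iff)
  ultimately have "(\<Prod>e\<in>edges G. \<phi> e) = (\<Prod>(v, u)\<in>Sigma B (neighbours G). \<phi> {u, v})"
    by (simp add: prod.reindex case_prod_unfold)
  thus ?thesis
    using fin by (simp add: prod.Sigma)
qed

text \<open>
  The function $F_v$ above. The neighbourhood \<open>N\<close> is a parameter because the same formula has to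
  be compared in two graphs, where it runs over $N(v)$ and over $\{w_1, \dots, w_b\}$.
\<close>

definition star_sum :: "nat \<Rightarrow> 'v weights \<Rightarrow> 'v set \<Rightarrow> 'v \<Rightarrow> ('v \<Rightarrow> nat) \<Rightarrow> real" where
  "star_sum m W N v g = (\<Sum>j\<in>{1..m}. vweight W j v * (\<Prod>u\<in>N. eweight W {g u, j} {u, v}))"

lemma star_sum_cong:
  assumes "\<And>u. u \<in> N \<Longrightarrow> g u = h u"
  shows "star_sum m W N v g = star_sum m W N v h"
  using assms by (simp add: star_sum_def cong: prod.cong)

text \<open>
  Every edge has exactly one endpoint in \<open>B\<close>, so for fixed spins \<open>g\<close> on \<open>A\<close> the weight is a product
  over \<open>v \<in> B\<close> of terms that involve only the spin of \<open>v\<close>, and the sum over the spins on \<open>B\<close>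
  becomes a product of sums.
\<close>

lemma partition_fun_bipartite:
  assumes "simple_graph G" "bipartition G A B"
  shows "partition_fun m G W = (\<Sum>g\<in>PiE A (\<lambda>_. {1..m}).
    (\<Prod>u\<in>A. vweight W (g u) u) * (\<Prod>v\<in>B. star_sum m W (neighbours G v) v g))"
proof -
  have V: "verts G = A \<union> B" and dis: "A \<inter> B = {}"
    using assms by (auto simp: bipartition_def)
  have fin: "finite A" "finite B"
    using assms V by (auto simp: simple_graph_def)
  have cw: "config_weight G W (\<lambda>x. if x \<in> A then g x else h x)
      = (\<Prod>u\<in>A. vweight W (g u) u) *
        (\<Prod>v\<in>B. vweight W (h v) v * (\<Prod>u\<in>neighbours G v. eweight W {g u, h v} {u, v}))"
    for g h
  proof -
    let ?f = "\<lambda>x. if x \<in> A then g x else h x"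
    have B: "?f v = h v" if "v \<in> B" for v
      using that dis by auto
    have "(\<Prod>v\<in>A \<union> B. vweight W (?f v) v) = (\<Prod>v\<in>A. vweight W (?f v) v) * (\<Prod>v\<in>B. vweight W (?f v) v)"
      using fin dis by (rule prod.union_disjoint)
    also have "\<dots> = (\<Prod>u\<in>A. vweight W (g u) u) * (\<Prod>v\<in>B. vweight W (h v) v)"
      by (simp add: B cong: prod.cong)
    finally have 1: "(\<Prod>v\<in>verts G. vweight W (?f v) v) = \<dots>"
      unfolding V .
    have "eweight W (?f ` {u, v}) {u, v} = eweight W {g u, h v} {u, v}"
      if "v \<in> B" "u \<in> neighbours G v" for u v
    proof -
      have "u \<in> A"
        using neighbours_subset_bipartition[OF assms(2)] that by blast
      thus ?thesis unfolding image_insert image_empty B[OF that(1)] by simp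
    qed
    hence 2: "(\<Prod>e\<in>edges G. eweight W (?f ` e) e)
        = (\<Prod>v\<in>B. \<Prod>u\<in>neighbours G v. eweight W {g u, h v} {u, v})"
      unfolding prod_edges_bipartite[OF assms] by (intro prod.cong refl)
    show ?thesis
      unfolding config_weight_def 1 2 by (simp add: prod.distrib mult.assoc)
  qed
  have "partition_fun m G W = (\<Sum>g\<in>PiE A (\<lambda>_. {1..m}). \<Sum>h\<in>PiE B (\<lambda>_. {1..m}).
      (\<Prod>u\<in>A. vweight W (g u) u) *
      (\<Prod>v\<in>B. vweight W (h v) v * (\<Prod>u\<in>neighbours G v. eweight W {g u, h v} {u, v})))"
    unfolding partition_fun_def V sum_PiE_Un[OF dis] cw ..
  also have "\<dots> = (\<Sum>g\<in>PiE A (\<lambda>_. {1..m}).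
      (\<Prod>u\<in>A. vweight W (g u) u) * (\<Prod>v\<in>B. star_sum m W (neighbours G v) v g))"
    unfolding star_sum_def prod_sum_PiE[OF fin(2) finite_atLeastAtMost] sum_distrib_left ..
  finally show ?thesis .
qed

text \<open>
  All vertices $z_\ell$ carry the weights of \<open>v\<close>, so each of them contributes the same factor,
  and identifying $w_k$ with the neighbour $n_k(v)$ turns the remaining sum into one over the
  spins on \<open>N\<close>.
\<close>

lemma partition_fun_induced:
  assumes "bij_betw n {1..b} N"
  shows "partition_fun m (complete_bipartite a b) (induced_weights W n v)
    = (\<Sum>h\<in>PiE N (\<lambda>_. {1..m}). (\<Prod>u\<in>N. vweight W (h u) u) * star_sum m W N v h ^ a)"
proof -
  let ?K = "complete_bipartite a b" and ?W = "induced_weights W n v"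
  let ?I = "Inl ` {1..b} :: (nat + nat) set"
  define \<phi> where "\<phi> = (case_sum n (\<lambda>l. v) :: nat + nat \<Rightarrow> 'a)"
  have K: "simple_graph ?K" "bipartition ?K ?I (Inr ` {1..a})"
    using biregular_complete_bipartite[of a b] by (auto simp: biregular_def)
  have nb: "neighbours ?K (Inr l) = ?I" if "l \<in> {1..a}" for l
    using that by (auto simp: neighbours_def complete_bipartite_def doubleton_eq_iff)
  have "\<phi> \<circ> Inl = n"
    by (simp add: \<phi>_def case_sum_o_inj)
  hence bij: "bij_betw \<phi> ?I N"
    using assms by (simp add: bij_betw_def inj_on_imageI image_comp)
  have star: "star_sum m ?W ?I (Inr l) (restrict (h \<circ> \<phi>) ?I) = star_sum m W N v h" for l h
  proof -
    have "(\<Prod>x\<in>?I. eweight ?W {restrict (h \<circ> \<phi>) ?I x, j} {x, Inr l})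
        = (\<Prod>u\<in>N. eweight W {h u, j} {u, v})" for j
      unfolding prod.reindex_bij_betw[OF bij, symmetric]
      by (intro prod.cong) (auto simp: \<phi>_def)
    thus ?thesis
      by (simp add: star_sum_def)
  qed
  have vw: "(\<Prod>x\<in>?I. vweight ?W (restrict (h \<circ> \<phi>) ?I x) x) = (\<Prod>u\<in>N. vweight W (h u) u)" for h
    unfolding prod.reindex_bij_betw[OF bij, symmetric]
    by (intro prod.cong) (auto simp: \<phi>_def)
  have "partition_fun m ?K ?W = (\<Sum>g\<in>PiE ?I (\<lambda>_. {1..m}).
      (\<Prod>x\<in>?I. vweight ?W (g x) x) * (\<Prod>l\<in>{1..a}. star_sum m ?W ?I (Inr l) g))"
  proof -
    have "(\<Prod>x\<in>Inr ` {1..a}. star_sum m ?W (neighbours ?K x) x g)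
        = (\<Prod>l\<in>{1..a}. star_sum m ?W ?I (Inr l) g)" for g
      unfolding prod.reindex[OF inj_Inr] o_def by (intro prod.cong refl) (simp only: nb)
    thus ?thesis
      unfolding partition_fun_bipartite[OF K] by simp
  qed
  also have "\<dots> = (\<Sum>h\<in>PiE N (\<lambda>_. {1..m}). (\<Prod>u\<in>N. vweight W (h u) u) * star_sum m W N v h ^ a)"
    unfolding sum_PiE_reindex[OF bij] star vw by simp
  finally show ?thesis .
qed

section \<open>The bound for biregular graphs\<close>

theorem theorem1p3:
  fixes G :: "'v sgraph" and EG OG :: "'v set" and a b m :: nat
    and W :: "'v weights" and n :: "'v \<Rightarrow> nat \<Rightarrow> 'v"
  assumes "a \<ge> 1" and "b \<ge> 1" and "m \<ge> 1"
    and "biregular a b G EG OG"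
    and "verts G \<noteq> {}"
    and "weight_system m G W"
    and "\<And>v. v \<in> OG \<Longrightarrow> bij_betw (n v) {1..b} (neighbours G v)"
  shows "partition_fun m G W
    \<le> (\<Prod>v\<in>OG. partition_fun m (complete_bipartite a b) (induced_weights W (n v) v)
                 powr (1 / real a))"
proof -
  let ?S = "{1..m}" and ?N = "neighbours G"
  let ?F = "\<lambda>v. star_sum m W (?N v) v"
  have G: "simple_graph G" "bipartition G EG OG" and deg: "\<And>u. u \<in> EG \<Longrightarrow> degree G u = a"
    using assms(4) by (auto simp: biregular_def)
  have V: "verts G = EG \<union> OG"
    using G(2) by (simp add: bipartition_def)
  have fin: "finite EG" "finite OG"
    using G(1) V by (auto simp: simple_graph_def)
  have N: "?N v \<subseteq> EG" if "v \<in> OG" for v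
    using neighbours_subset_bipartition[OF G(2) that] .
  have card: "card {v \<in> OG. u \<in> ?N v} = a" if "u \<in> EG" for u
  proof -
    have "{v \<in> OG. u \<in> ?N v} = ?N u"
      using G(2) that
      by (fastforce simp: bipartition_def neighbours_def insert_commute doubleton_eq_iff)
    thus ?thesis
      using deg[OF that] by (simp add: degree_def)
  qed
  have \<mu>: "0 \<le> vweight W i u" if "u \<in> verts G" "i \<in> ?S" for u i
    using assms(6) that by (auto simp: weight_system_def)
  have F0: "0 \<le> ?F v g" if "v \<in> OG" "g \<in> PiE (?N v) (\<lambda>_. ?S)" for v g
  proof -
    have "0 \<le> eweight W {g u, j} {u, v}" if "u \<in> ?N v" "j \<in> ?S" for u j
      using assms(6) that PiE_mem[OF \<open>g \<in> _\<close> that(1)]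
      by (auto simp: weight_system_def neighbours_def)
    thus ?thesis
      using \<mu> that(1) V unfolding star_sum_def by (intro sum_nonneg mult_nonneg_nonneg prod_nonneg) auto
  qed
  have "partition_fun m G W = (\<Sum>g\<in>PiE EG (\<lambda>_. ?S).
      (\<Prod>u\<in>EG. vweight W (g u) u) * (\<Prod>v\<in>OG. ?F v (restrict g (?N v))))"
    unfolding partition_fun_bipartite[OF G]
    by (intro sum.cong arg_cong2[where f = "(*)"] prod.cong star_sum_cong) auto
  also have "\<dots> \<le> (\<Prod>v\<in>OG. root a
      (\<Sum>h\<in>PiE (?N v) (\<lambda>_. ?S). (\<Prod>u\<in>?N v. vweight W (h u) u) * ?F v h ^ a))"
    using fin assms(1) N card \<mu> F0 V
    by (intro finner_inequality[where \<mu> = "\<lambda>u i. vweight W i u"]) auto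
  also have "\<dots> = (\<Prod>v\<in>OG. partition_fun m (complete_bipartite a b) (induced_weights W (n v) v)
      powr (1 / real a))"
  proof (intro prod.cong refl)
    fix v assume v: "v \<in> OG"
    have "0 \<le> vweight W (h u) u" if "h \<in> PiE (?N v) (\<lambda>_. ?S)" "u \<in> ?N v" for h u
      using \<mu>[OF _ PiE_mem[OF that]] N[OF v] V that(2) by blast
    hence "0 \<le> (\<Sum>h\<in>PiE (?N v) (\<lambda>_. ?S). (\<Prod>u\<in>?N v. vweight W (h u) u) * ?F v h ^ a)"
      using F0[OF v] by (intro sum_nonneg mult_nonneg_nonneg prod_nonneg zero_le_power) auto
    thus "root a (\<Sum>h\<in>PiE (?N v) (\<lambda>_. ?S). (\<Prod>u\<in>?N v. vweight W (h u) u) * ?F v h ^ a)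
        = partition_fun m (complete_bipartite a b) (induced_weights W (n v) v) powr (1 / real a)"
      unfolding partition_fun_induced[OF assms(7)[OF v]]
      using assms(1) by (simp add: root_powr_inverse)
  qed
  finally show ?thesis .
qed

end
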